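(* There exist a family of partial Boolean functions $(f_n)_{n\ge 1}$ and a family of partial Boolean functions $(g_n)_{n\ge 1}$ such that $\mathrm{R}(f_n)\to\infty$ and $\mathrm{R}(g_n)\to\infty$ as $n\to\infty$, and \[\mathrm{R}(f_n\circ g_n)=O\!\left(\mathrm{R}(f_n)^{2/3}\,\mathrm{R}(g_n)^{2/3}\,\log^{2/3}\mathrm{R}(f_n)\right).\]
   Context: A partial Boolean function on $n$ bits is a map $f\colon S\to\{0,1\}$ with $S=\mathrm{Dom}(f)\subseteq\{0,1\}^n$. A randomized decision tree is a probability distribution over deterministic decision trees; it computes $f$ to error $\epsilon$ if on every $x\in\mathrm{Dom}(f)$ it outputs $f(x)$ with probability at least $1-\epsilon$. $\mathrm{R}(f)$ denotes the minimum, over randomized decision trees computing $f$ to error $1/3$, of the maximum number of queries made by any decision tree in its support. For partial Boolean functions $f$ on $n$ bits and $g$ on $m$ bits, the composition $f\circ g$ is the partial function on $nm$ bits whose domain consists of strings $x^1x^2\cdots x^n$ with each $x^i\in\mathrm{Dom}(g)$ and $g(x^1)\cdots g(x^n)\in\mathrm{Dom}(f)$, with value $f(g(x^1)\cdots g(x^n))$. *)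

theory Defs
  imports "HOL-Probability.Probability" "HOL-Library.Landau_Symbols"
begin

text \<open>A partial Boolean function on \<open>n\<close> bits is a partial map on bit strings whose domain,
  an arbitrary subset, contains only strings of length \<open>n\<close>.\<close>

type_synonym pbf = "bool list \<Rightarrow> bool option"

definition is_pbf :: "nat \<Rightarrow> pbf \<Rightarrow> bool" where
  "is_pbf n f \<longleftrightarrow> dom f \<subseteq> {x. length x = n}"

datatype dtree = Leaf bool | Query nat dtree dtree

primrec dt_eval :: "dtree \<Rightarrow> bool list \<Rightarrow> bool" where
  "dt_eval (Leaf b) x = b"
| "dt_eval (Query i t0 t1) x = (if x ! i then dt_eval t1 x else dt_eval t0 x)"

primrec dt_depth :: "dtree \<Rightarrow> nat" where
  "dt_depth (Leaf b) = 0"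
| "dt_depth (Query i t0 t1) = Suc (max (dt_depth t0) (dt_depth t1))"

text \<open>Decision trees on \<open>n\<close> bits query only positions below \<open>n\<close>; this excludes the
  unspecified values of \<open>x ! i\<close> beyond the length of \<open>x\<close>.\<close>

primrec dt_on :: "nat \<Rightarrow> dtree \<Rightarrow> bool" where
  "dt_on n (Leaf b) \<longleftrightarrow> True"
| "dt_on n (Query i t0 t1) \<longleftrightarrow> i < n \<and> dt_on n t0 \<and> dt_on n t1"

definition rdt_on :: "nat \<Rightarrow> dtree pmf \<Rightarrow> bool" where
  "rdt_on n P \<longleftrightarrow> (\<forall>t\<in>set_pmf P. dt_on n t)"

definition rdt_computes :: "dtree pmf \<Rightarrow> pbf \<Rightarrow> real \<Rightarrow> bool" where
  "rdt_computes P f \<epsilon> \<longleftrightarrow>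
     (\<forall>x\<in>dom f. measure_pmf.prob P {t. dt_eval t x = the (f x)} \<ge> 1 - \<epsilon>)"

text \<open>The minimum is over the randomized trees whose support has bounded depth. The bound is
  quantified explicitly because the supremum of an unbounded set of naturals is \<open>0\<close> in HOL.\<close>

definition rand_query :: "nat \<Rightarrow> pbf \<Rightarrow> nat" where
  "rand_query n f =
     (LEAST k. \<exists>P. rdt_on n P \<and> rdt_computes P f (1/3) \<and> (\<forall>t\<in>set_pmf P. dt_depth t \<le> k))"

definition blocks :: "nat \<Rightarrow> nat \<Rightarrow> bool list \<Rightarrow> bool list list" where
  "blocks n m x = map (\<lambda>i. take m (drop (i * m) x)) [0..<n]"

text \<open>The requirement that the string of inner values lies in \<open>dom f\<close> is implicit:
  otherwise the result is \<open>None\<close>.\<close>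

definition pbf_comp :: "nat \<Rightarrow> nat \<Rightarrow> pbf \<Rightarrow> pbf \<Rightarrow> pbf" where
  "pbf_comp n m f g = (\<lambda>x.
     if length x = n * m \<and> (\<forall>y\<in>set (blocks n m x). y \<in> dom g)
     then f (map (\<lambda>y. the (g y)) (blocks n m x))
     else None)"

lemma is_pbf_comp: "is_pbf (n * m) (pbf_comp n m f g)"
  by (auto simp: is_pbf_def pbf_comp_def split: if_splits)

text \<open>The set minimised over is nonempty: a tree querying all \<open>n\<close> bits computes \<open>f\<close>
  exactly.\<close>

lemma ex_full_tree:
  "k \<le> n \<Longrightarrow> \<exists>t. dt_on n t \<and> dt_depth t \<le> k \<and> (\<forall>x. dt_eval t x = h (map ((!) x) [0..<k]))"
proof (induction k arbitrary: h)
  case 0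
  show ?case by (rule exI[of _ "Leaf (h [])"]) simp
next
  case (Suc k)
  from Suc.IH[of "\<lambda>xs. h (xs @ [False])"] Suc.prems obtain t0 where
    t0: "dt_on n t0" "dt_depth t0 \<le> k" "\<And>x. dt_eval t0 x = h (map ((!) x) [0..<k] @ [False])"
    by auto
  from Suc.IH[of "\<lambda>xs. h (xs @ [True])"] Suc.prems obtain t1 where
    t1: "dt_on n t1" "dt_depth t1 \<le> k" "\<And>x. dt_eval t1 x = h (map ((!) x) [0..<k] @ [True])"
    by auto
  show ?case
    by (rule exI[of _ "Query k t0 t1"]) (use t0 t1 Suc.prems in auto)
qed

lemma rand_query_attained:
  assumes "is_pbf n f"
  shows "\<exists>P. rdt_on n P \<and> rdt_computes P f (1/3) \<and> (\<forall>t\<in>set_pmf P. dt_depth t \<le> rand_query n f)"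
proof -
  obtain t where t: "dt_on n t" "dt_depth t \<le> n"
      "\<And>x. dt_eval t x = the (f (map ((!) x) [0..<n]))"
    using ex_full_tree[of n n "\<lambda>x. the (f x)"] by auto
  have "dt_eval t x = the (f x)" if "x \<in> dom f" for x
  proof -
    have "length x = n" using that assms by (auto simp: is_pbf_def)
    then show ?thesis using t(3)[of x] by (metis map_nth)
  qed
  then have "rdt_computes (return_pmf t) f (1/3)"
    by (simp add: rdt_computes_def)
  with t have "\<exists>P. rdt_on n P \<and> rdt_computes P f (1/3) \<and> (\<forall>t\<in>set_pmf P. dt_depth t \<le> n)"
    by (intro exI[of _ "return_pmf t"]) (simp add: rdt_on_def)
  then show ?thesis unfolding rand_query_def by (rule LeastI)
qed

end

theory Submission
  imports Defs "HOL-Real_Asymp.Real_Asymp"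
begin

text \<open>The outer function hides its value in an array indexed by \<open>{0,1}\<^sup>k\<close>: only the cells whose
  index agrees with a secret address \<open>a\<close> in at least \<open>k/2 + s\<close> places carry information. A tree
  making at most \<open>s\<close> queries learns too little of \<open>a\<close> to find such a cell, since by Hoeffding each
  cell it tries is informative with probability at most \<open>exp (- s\<^sup>2 / (2 k))\<close>. A string whose bits
  all have bias \<open>2 s / k\<close> towards \<open>a\<close> is however the index of an informative cell with high
  probability. The inner function, majority with relative gap \<open>\<delta> = 2 s / k\<close>, has complexity of order
  \<open>1 / \<delta>\<^sup>2\<close>, but a single random query already gives its value with bias \<open>\<delta>\<close>. So the composition is
  solved by one query into each of the \<open>k\<close> address blocks followed by reading one cell completely.
  The theorem follows by taking \<open>k = n\<^sup>2 4\<^sup>n\<close> and \<open>s = n\<^sup>2 2\<^sup>n\<close>, which makes \<open>s\<^sup>2 / k = n\<^sup>2\<close> and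
  \<open>\<delta> = 2 / 2\<^sup>n\<close>.\<close>

section \<open>Independent coins\<close>

text \<open>Hoeffding's inequality for a number of successes. The event \<open>Q\<close> may depend
  on the trial, so that one statement serves biased coins as well as agreement with a prescribed
  string.\<close>

lemma
  fixes Q :: "nat \<Rightarrow> 'a \<Rightarrow> bool" and p :: "nat \<Rightarrow> 'a pmf" and \<epsilon> :: real
  assumes n: "n > 0" and \<epsilon>: "\<epsilon> \<ge> 0"
  shows prob_Pi_pmf_count_ge:
      "measure_pmf.prob (Pi_pmf {..<n} d p)
         {x. real (card {i. i < n \<and> Q i (x i)}) \<ge> (\<Sum>i<n. measure_pmf.prob (p i) {y. Q i y}) + \<epsilon>}
       \<le> exp (-2 * \<epsilon>\<^sup>2 / n)" (is ?ge)
    and prob_Pi_pmf_count_le: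
      "measure_pmf.prob (Pi_pmf {..<n} d p)
         {x. real (card {i. i < n \<and> Q i (x i)}) \<le> (\<Sum>i<n. measure_pmf.prob (p i) {y. Q i y}) - \<epsilon>}
       \<le> exp (-2 * \<epsilon>\<^sup>2 / n)" (is ?le)
proof -
  define D where "D = Pi_pmf {..<n} d p"
  define X where "X = (\<lambda>i x. indicator {y. Q i y} (x i) :: real)"
  define \<mu> where "\<mu> = (\<Sum>i<n. measure_pmf.expectation D (X i))"
  have X_sum: "(\<Sum>i<n. X i x) = real (card {i. i < n \<and> Q i (x i)})" for x
  proof -
    have "(\<Sum>i<n. X i x) = (\<Sum>i\<in>{i. i < n \<and> Q i (x i)}. 1)"
      unfolding X_def by (intro sum.mono_neutral_cong_right) (auto simp: indicator_def)
    thus ?thesis by simp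
  qed
  have "measure_pmf.expectation D (X i) = measure_pmf.prob (p i) {y. Q i y}" if "i < n" for i
  proof -
    have "measure_pmf.expectation D (X i) =
        measure_pmf.expectation (map_pmf (\<lambda>x. x i) D) (indicator {y. Q i y})"
      by (simp only: X_def integral_map_pmf)
    also have "map_pmf (\<lambda>x. x i) D = p i"
      using that by (simp add: D_def Pi_pmf_component)
    finally show ?thesis by simp
  qed
  hence \<mu>_eq: "\<mu> = (\<Sum>i<n. measure_pmf.prob (p i) {y. Q i y})"
    unfolding \<mu>_def by (intro sum.cong) auto
  interpret Hoeffding_ineq "measure_pmf D" "{..<n}" X "\<lambda>_. 0" "\<lambda>_. 1" \<mu>
  proof unfold_locales
    show "prob_space.indep_vars (measure_pmf D) (\<lambda>_. borel) X {..<n}"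
      unfolding D_def X_def
      by (intro prob_space.indep_vars_compose2[OF _ indep_vars_Pi_pmf])
         (auto simp: measure_pmf.prob_space_axioms)
    show "\<mu> \<equiv> \<Sum>i<n. measure_pmf.expectation D (X i)" by (simp add: \<mu>_def)
  qed (auto simp: X_def)
  show ?ge using Hoeffding_ineq_ge[OF \<epsilon>] n by (simp add: X_sum \<mu>_eq D_def)
  show ?le using Hoeffding_ineq_le[OF \<epsilon>] n by (simp add: X_sum \<mu>_eq D_def)
qed

text \<open>Turns the probability of an event into a point mass, to which the laws of bind
  apply.\<close>

lemma prob_eq_pmf_map: "measure_pmf.prob E {z. R z} = pmf (map_pmf R E) True"
  by (simp add: pmf_map vimage_def)

text \<open>Every coin has its own parameter so that the family is closed under conditioning: a bit
  already read is a coin with parameter 0 or 1.\<close>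

definition coins :: "nat \<Rightarrow> (nat \<Rightarrow> real) \<Rightarrow> (nat \<Rightarrow> bool) pmf" where
  "coins n p = Pi_pmf {..<n} False (\<lambda>i. bernoulli_pmf (p i))"

lemma bernoulli_pmf_of_bool: "bernoulli_pmf (of_bool c) = return_pmf c"
  by (rule pmf_eqI) (cases c; auto simp: pmf_return split: split_indicator split: bool.splits)

lemma coins_fixed:
  assumes "i < n" "x \<in> set_pmf (coins n (p(i := of_bool c)))"
  shows "x i = c"
proof -
  have "set_pmf (map_pmf (\<lambda>x. x i) (coins n (p(i := of_bool c)))) = {c}"
    using assms(1) by (simp add: coins_def Pi_pmf_component bernoulli_pmf_of_bool)
  with assms(2) show ?thesis by auto
qed

lemma coins_split:
  assumes "i < n"
  shows "coins n p = bernoulli_pmf (p i) \<bind> (\<lambda>c. coins n (p(i := of_bool c)))"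
proof -
  define A where "A = {..<n} - {i}"
  have A: "{..<n} = insert i A" "finite A" "i \<notin> A" using assms by (auto simp: A_def)
  have *: "Pi_pmf A False (\<lambda>j. bernoulli_pmf (if j = i then q else p j)) =
      Pi_pmf A False (\<lambda>j. bernoulli_pmf (p j))" for q
    using A by (intro Pi_pmf_cong) auto
  show ?thesis unfolding coins_def A(1)
    using A(2,3) by (simp add: Pi_pmf_insert' bernoulli_pmf_of_bool bind_return_pmf * fun_upd_def)
qed

lemma prob_coins_split:
  assumes "i < n" "0 \<le> p i" "p i \<le> 1"
  shows "measure_pmf.prob (coins n p) S =
     p i * measure_pmf.prob (coins n (p(i := 1))) S
     + (1 - p i) * measure_pmf.prob (coins n (p(i := 0))) S"
proof -
  have "measure_pmf.prob (coins n p) S =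
      measure_pmf.expectation (bernoulli_pmf (p i))
        (\<lambda>c. measure_pmf.prob (coins n (p(i := of_bool c))) S)"
    using prob_eq_pmf_map[where R = "\<lambda>x. x \<in> S"]
    by (subst coins_split[OF assms(1)]) (simp add: map_bind_pmf pmf_bind)
  thus ?thesis using assms(2,3) by simp
qed

section \<open>Averaging over the random tree\<close>

text \<open>Fubini: both sides are the probability of \<open>Q t x\<close> for independent
  \<open>t\<close> and \<open>x\<close>, and independent draws commute.\<close>

lemma expectation_prob_swap:
  fixes P :: "'a pmf" and D :: "'b pmf"
  shows "measure_pmf.expectation P (\<lambda>t. measure_pmf.prob D {x. Q t x}) =
         measure_pmf.expectation D (\<lambda>x. measure_pmf.prob P {t. Q t x})"
proof -
  have "pmf (P \<bind> (\<lambda>t. map_pmf (Q t) D)) True = pmf (D \<bind> (\<lambda>x. map_pmf (\<lambda>t. Q t x) P)) True"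
    unfolding map_pmf_def by (subst bind_commute_pmf) (rule refl)
  thus ?thesis by (simp only: prob_eq_pmf_map pmf_bind)
qed

text \<open>The easy direction of Yao's principle. A tree drawn from \<open>P\<close> is correct
  with average probability at least 2/3 * (1 - \<eta>) on each distribution, so some tree reaches
  4/3 * (1 - \<eta>) for the sum. The slack \<eta> permits distributions that sometimes leave the
  domain of \<open>f\<close>.\<close>

lemma rand_query_distinguisher:
  assumes f: "is_pbf n f"
    and D1: "measure_pmf.prob D1 {x. f x = Some True} \<ge> 1 - \<eta>"
    and D0: "measure_pmf.prob D0 {x. f x = Some False} \<ge> 1 - \<eta>"
  shows "\<exists>t. dt_on n t \<and> dt_depth t \<le> rand_query n f \<and>
    measure_pmf.prob D1 {x. dt_eval t x} - measure_pmf.prob D0 {x. dt_eval t x} \<ge> 1/3 - 4/3 * \<eta>"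
proof -
  obtain P where P: "rdt_on n P" "rdt_computes P f (1/3)"
      "\<And>t. t \<in> set_pmf P \<Longrightarrow> dt_depth t \<le> rand_query n f"
    using rand_query_attained[OF f] by blast
  have avg: "measure_pmf.expectation P (\<lambda>t. measure_pmf.prob D {x. dt_eval t x = b}) \<ge> 2/3 * (1 - \<eta>)"
    if D: "measure_pmf.prob D {x. f x = Some b} \<ge> 1 - \<eta>" for D b
  proof -
    have "2/3 * (1 - \<eta>) \<le> 2/3 * measure_pmf.prob D {x. f x = Some b}" using D by simp
    also have "\<dots> = measure_pmf.expectation D (\<lambda>x. 2/3 * indicator {x. f x = Some b} x)" by simp
    also have "\<dots> \<le> measure_pmf.expectation D (\<lambda>x. measure_pmf.prob P {t. dt_eval t x = b})"
    proof (rule integral_mono)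
      show "integrable D (\<lambda>x. measure_pmf.prob P {t. dt_eval t x = b})"
        by (rule measure_pmf.integrable_const_bound[where B = 1]) auto
      fix x
      show "2/3 * indicator {x. f x = Some b} x \<le> measure_pmf.prob P {t. dt_eval t x = b}"
        using P(2) by (cases "f x = Some b") (force simp: rdt_computes_def)+
      show "integrable D (\<lambda>x. 2/3 * indicator {x. f x = Some b} x :: real)"
        by (rule measure_pmf.integrable_const_bound[where B = 1]) (auto simp: indicator_def)
    qed
    also have "\<dots> = measure_pmf.expectation P (\<lambda>t. measure_pmf.prob D {x. dt_eval t x = b})"
      by (rule expectation_prob_swap[symmetric])
    finally show ?thesis .
  qed
  define V where "V = (\<lambda>t. measure_pmf.prob D1 {x. dt_eval t x = True} +
      measure_pmf.prob D0 {x. dt_eval t x = False})"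
  have int: "integrable P (\<lambda>t. measure_pmf.prob D {x. dt_eval t x = b})" for D b
    by (rule measure_pmf.integrable_const_bound[where B = 1]) auto
  have intV: "integrable P V" unfolding V_def by (intro Bochner_Integration.integrable_add int)
  have "measure_pmf.expectation P V \<ge> 4/3 * (1 - \<eta>)"
    unfolding V_def using avg[OF D1] avg[OF D0]
    by (subst Bochner_Integration.integral_add[OF int int]) simp
  \<comment> \<open>If every tree fell strictly below the bound, so would the mean, even over an
    infinite support.\<close>
  moreover have "measure_pmf.expectation P V < 4/3 * (1 - \<eta>)" if "\<forall>t\<in>set_pmf P. V t < 4/3 * (1 - \<eta>)"
    using that intV by (intro measure_pmf.expectation_less) (auto simp: AE_measure_pmf_iff)
  ultimately obtain t where t: "t \<in> set_pmf P" "V t \<ge> 4/3 * (1 - \<eta>)" by force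
  have "measure_pmf.prob D0 {x. dt_eval t x = False} = 1 - measure_pmf.prob D0 {x. dt_eval t x}"
    using measure_pmf.prob_compl[of "{x. dt_eval t x}" D0] by (simp add: Collect_neg_eq Compl_eq_Diff_UNIV)
  with t P show ?thesis
    by (intro exI[of _ t]) (auto simp: V_def rdt_on_def algebra_simps)
qed

section \<open>The gap majority function\<close>

definition accept_prob :: "nat \<Rightarrow> (nat \<Rightarrow> real) \<Rightarrow> dtree \<Rightarrow> real" where
  "accept_prob n p t = measure_pmf.prob (coins n p) {x. dt_eval t (map x [0..<n])}"

lemma accept_prob_Leaf [simp]: "accept_prob n p (Leaf b) = of_bool b"
  by (simp add: accept_prob_def)

text \<open>The subtree runs on the coins conditioned on the answer, so a repeated query of
  \<open>i\<close> is answered consistently.\<close>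

lemma accept_prob_Query:
  assumes "i < n" "0 \<le> p i" "p i \<le> 1"
  shows "accept_prob n p (Query i t0 t1) =
    p i * accept_prob n (p(i := 1)) t1 + (1 - p i) * accept_prob n (p(i := 0)) t0"
proof -
  have "measure_pmf.prob (coins n (p(i := of_bool c))) {x. dt_eval (Query i t0 t1) (map x [0..<n])}
      = accept_prob n (p(i := of_bool c)) (if c then t1 else t0)" for c
    unfolding accept_prob_def using assms(1) coins_fixed[OF assms(1), of _ p c]
    by (intro measure_pmf.finite_measure_eq_AE) (force simp: AE_measure_pmf_iff)+
  from this[of True] this[of False] show ?thesis
    unfolding accept_prob_def[of n p] by (subst prob_coins_split[of i]) (use assms in auto)
qed

text \<open>With \<open>v\<close> and \<open>u\<close> the two acceptance probabilities, maximising the left-hand side over \<open>\<alpha>\<close> and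
  \<open>\<beta>\<close> gives \<open>v\<^sup>2 / u + (1 - v)\<^sup>2 / (1 - u)\<close>, one plus the chi-square divergence of the output
  distributions; the quadratic form makes each query cost a factor \<open>1 + 4 * e\<^sup>2\<close> exactly and
  avoids divisions by zero.\<close>

lemma chi_square_tree:
  fixes e \<alpha> \<beta> :: real and p r :: "nat \<Rightarrow> real"
  assumes "\<bar>e\<bar> < 1/2" "dt_on n t" "dt_depth t \<le> q"
    and "\<And>i. i < n \<Longrightarrow> (p i = 1/2 + e \<and> r i = 1/2) \<or> (p i = 1 \<and> r i = 1) \<or> (p i = 0 \<and> r i = 0)"
  shows "2 * \<alpha> * accept_prob n p t - \<alpha>\<^sup>2 * accept_prob n r t
    + 2 * \<beta> * (1 - accept_prob n p t) - \<beta>\<^sup>2 * (1 - accept_prob n r t) \<le> (1 + 4 * e\<^sup>2) ^ q"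
  using assms(2-)
proof (induction t arbitrary: p r \<alpha> \<beta> q)
  case (Leaf b)
  have "2 * z - z\<^sup>2 \<le> (1::real)" for z
    using zero_le_power2[of "z - 1"] by (simp add: power2_eq_square algebra_simps)
  from order_trans[OF this, of "(1 + 4 * e\<^sup>2) ^ q"] show ?case by (cases b) (simp_all add: one_le_power)
next
  case (Query i t0 t1)
  then obtain q' where q: "q = Suc q'" "dt_depth t0 \<le> q'" "dt_depth t1 \<le> q'" by (cases q) auto
  have i: "i < n" "dt_on n t0" "dt_on n t1" using Query.prems by auto
  let ?M = "1 + 4 * e\<^sup>2"
  have M: "?M ^ q' \<le> ?M ^ q" unfolding q by (intro power_increasing) auto
  have pr: "0 \<le> p i" "p i \<le> 1" "0 \<le> r i" "r i \<le> 1" using Query.prems(3)[OF i(1)] assms(1) by auto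
  note acc = accept_prob_Query[of i n p, OF i(1) pr(1,2)] accept_prob_Query[of i n r, OF i(1) pr(3,4)]
  consider "p i = 1/2 + e" "r i = 1/2" | "p i = 1" "r i = 1" | "p i = 0" "r i = 0"
    using Query.prems(3)[OF i(1)] by blast
  thus ?case
  proof cases
    case 1
    define v1 v0 u1 u0 where "v1 = accept_prob n (p(i := 1)) t1" and "v0 = accept_prob n (p(i := 0)) t0"
      and "u1 = accept_prob n (r(i := 1)) t1" and "u0 = accept_prob n (r(i := 0)) t0"
    define F where "F = (\<lambda>\<alpha> \<beta> v u :: real. 2 * \<alpha> * v - \<alpha>\<^sup>2 * u + 2 * \<beta> * (1 - v) - \<beta>\<^sup>2 * (1 - u))"
    have F1: "F a b v1 u1 \<le> ?M ^ q'" for a b unfolding F_def v1_def u1_def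
      by (rule Query.IH(2)) (use Query.prems q in auto)
    have F0: "F a b v0 u0 \<le> ?M ^ q'" for a b unfolding F_def v0_def u0_def
      by (rule Query.IH(1)) (use Query.prems q in auto)
    \<comment> \<open>The likelihood ratios of the two answers, biased against fair.\<close>
    define c d where "c = 1 + 2 * e" and "d = 1 - 2 * e"
    have cd: "c > 0" "d > 0" using assms(1) by (auto simp: c_def d_def)
    \<comment> \<open>Rescaling \<alpha> and \<beta> absorbs the likelihood ratio of an answer; this
      is why the induction generalises over both.\<close>
    have scale: "k\<^sup>2 * F (\<alpha>/k) (\<beta>/k) v u =
        k * (2 * \<alpha> * v + 2 * \<beta> * (1 - v)) - (\<alpha>\<^sup>2 * u + \<beta>\<^sup>2 * (1 - u))"
      if "k > 0" for k v u
      using that by (simp add: F_def field_simps power2_eq_square)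
    have "F \<alpha> \<beta> (c/2 * v1 + d/2 * v0) ((u1 + u0) / 2) =
        (c\<^sup>2 * F (\<alpha>/c) (\<beta>/c) v1 u1 + d\<^sup>2 * F (\<alpha>/d) (\<beta>/d) v0 u0) / 2"
      unfolding scale[OF cd(1)] scale[OF cd(2)] by (simp add: F_def c_def d_def field_simps)
    also have "\<dots> \<le> (c\<^sup>2 * ?M ^ q' + d\<^sup>2 * ?M ^ q') / 2"
      by (intro divide_right_mono add_mono mult_left_mono F1 F0) auto
    \<comment> \<open>The cost of a query is the mean of \<open>c\<^sup>2\<close> and
      \<open>d\<^sup>2\<close>, which is \<open>?M\<close>.\<close>
    also have "\<dots> = ?M ^ q" by (simp add: q c_def d_def power2_eq_square field_simps)
    finally show ?thesis unfolding acc 1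
      by (simp add: F_def v1_def v0_def u1_def u0_def c_def d_def field_simps)
  next
    \<comment> \<open>A bit known under both distributions carries no information, so the bound for
      \<open>q'\<close> suffices.\<close>
    case 2
    have "2 * \<alpha> * accept_prob n (p(i:=1)) t1 - \<alpha>\<^sup>2 * accept_prob n (r(i:=1)) t1
      + 2 * \<beta> * (1 - accept_prob n (p(i:=1)) t1) - \<beta>\<^sup>2 * (1 - accept_prob n (r(i:=1)) t1) \<le> ?M ^ q'"
      by (rule Query.IH(2)) (use Query.prems q in auto)
    thus ?thesis unfolding acc 2 using M by simp
  next
    case 3
    have "2 * \<alpha> * accept_prob n (p(i:=0)) t0 - \<alpha>\<^sup>2 * accept_prob n (r(i:=0)) t0
      + 2 * \<beta> * (1 - accept_prob n (p(i:=0)) t0) - \<beta>\<^sup>2 * (1 - accept_prob n (r(i:=0)) t0) \<le> ?M ^ q'"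
      by (rule Query.IH(1)) (use Query.prems q in auto)
    thus ?thesis unfolding acc 3 using M by simp
  qed
qed

text \<open>For \<beta> = 1 and \<alpha> = 1 + z the form in \<open>chi_square_tree\<close> equals 1
  + 2 * z * (v - u) - z^2 * u, with v and u the biased and the fair acceptance probability. Taking z
  = 1/8 and z = -1/8 bounds v - u from both sides.\<close>

lemma accept_prob_biased_coins:
  fixes e :: real
  assumes e: "\<bar>e\<bar> < 1/2" and t: "dt_on n t" "dt_depth t \<le> q" and q: "(1 + 4 * e\<^sup>2) ^ q \<le> 65/64"
  shows "\<bar>accept_prob n (\<lambda>_. 1/2 + e) t - accept_prob n (\<lambda>_. 1/2) t\<bar> \<le> 1/8"
proof -
  define v u where "v = accept_prob n (\<lambda>_. 1/2 + e) t" and "u = accept_prob n (\<lambda>_. 1/2) t"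
  have "u \<le> 1" by (simp add: u_def accept_prob_def)
  have *: "2 * \<alpha> * v - \<alpha>\<^sup>2 * u + 2 * 1 * (1 - v) - 1\<^sup>2 * (1 - u) \<le> 65/64" for \<alpha>
    unfolding v_def u_def by (rule order_trans[OF chi_square_tree[OF e t] q]) auto
  from *[of "9/8"] *[of "7/8"] \<open>u \<le> 1\<close> have "\<bar>v - u\<bar> \<le> 1/8"
    unfolding abs_le_iff by (simp add: power2_eq_square)
  thus ?thesis by (simp add: v_def u_def)
qed

text \<open>The gap \<gamma> counts positions: for m > 0, a uniformly random position shows the
  value with probability at least 1/2 + \<gamma> / m.\<close>

definition gap_maj :: "nat \<Rightarrow> real \<Rightarrow> pbf" where
  "gap_maj m \<gamma> x =
    (if length x \<noteq> m then None
     else if real (card {i. i < m \<and> x ! i}) \<ge> m/2 + \<gamma> then Some True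
     else if real (card {i. i < m \<and> x ! i}) \<le> m/2 - \<gamma> then Some False
     else None)"

lemma is_pbf_gap_maj: "is_pbf m (gap_maj m \<gamma>)"
  by (auto simp: is_pbf_def gap_maj_def split: if_splits)

text \<open>Coins biased up and coins biased down mostly give inputs of opposite value, yet a
  shallow tree can tell neither from fair coins.\<close>

lemma rand_query_gap_maj:
  fixes \<gamma> :: real
  assumes m: "m > 0" and \<gamma>: "\<gamma> > 0" "4 * \<gamma> < m" "exp (-2 * \<gamma>\<^sup>2 / m) \<le> 1/33"
  shows "(1 + 4 * (2 * \<gamma> / m)\<^sup>2) ^ rand_query m (gap_maj m \<gamma>) > 65/64"
proof (rule ccontr)
  \<comment> \<open>This bias moves the mean to m/2 + 2 * \<gamma>, which leaves a margin of
    \<gamma> for Hoeffding's bound.\<close>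
  define e where "e = 2 * \<gamma> / m"
  assume "\<not> ?thesis"
  hence q: "(1 + 4 * e\<^sup>2) ^ rand_query m (gap_maj m \<gamma>) \<le> 65/64" by (simp add: e_def)
  have e: "\<bar>e\<bar> < 1/2" "\<bar>-e\<bar> < 1/2" using \<gamma> m by (auto simp: e_def field_simps)
  have me: "m * e = 2 * \<gamma>" using m by (simp add: e_def)
  define D where "D = (\<lambda>e. map_pmf (\<lambda>x. map x [0..<m]) (coins m (\<lambda>_. 1/2 + e)))"
  have card_eq: "{i. i < m \<and> map x [0..<m] ! i} = {i. i < m \<and> x i}" for x by auto
  have sum_eq: "(\<Sum>i<m. measure_pmf.prob (bernoulli_pmf (1/2 + e')) {y. y}) = m/2 + m * e'"
    if "\<bar>e'\<bar> < 1/2" for e' :: real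
    using that by (simp add: prob_eq_pmf_map algebra_simps)
  have small: "measure_pmf.prob E S \<ge> 1 - 1/33"
    if "measure_pmf.prob E (-S) \<le> 1/33" for E :: "bool list pmf" and S
    using that measure_pmf.prob_compl[of S E] by (simp add: Compl_eq_Diff_UNIV)
  have D1: "measure_pmf.prob (D e) {x. gap_maj m \<gamma> x = Some True} \<ge> 1 - 1/33"
  proof (rule small)
    have "measure_pmf.prob (D e) (- {x. gap_maj m \<gamma> x = Some True}) =
        measure_pmf.prob (coins m (\<lambda>_. 1/2 + e)) {x. \<not> real (card {i. i < m \<and> x i}) \<ge> m/2 + \<gamma>}"
      unfolding D_def measure_map_pmf using \<gamma>
      by (intro arg_cong[where f = "measure_pmf.prob _"]) (auto simp: gap_maj_def card_eq)
    also have "\<dots> \<le> measure_pmf.prob (coins m (\<lambda>_. 1/2 + e))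
          {x. real (card {i. i < m \<and> x i}) \<le> m/2 + m * e - \<gamma>}"
      by (intro measure_pmf.finite_measure_mono) (auto simp: me)
    also have "\<dots> \<le> exp (-2 * \<gamma>\<^sup>2 / m)"
      unfolding coins_def
      using prob_Pi_pmf_count_le[OF m, where \<epsilon> = \<gamma> and Q = "\<lambda>_ y. y"
        and p = "\<lambda>_. bernoulli_pmf (1/2 + e)"] \<gamma>
      unfolding sum_eq[OF e(1)] by auto
    finally show "measure_pmf.prob (D e) (- {x. gap_maj m \<gamma> x = Some True}) \<le> 1/33"
      using \<gamma>(3) by simp
  qed
  have D0: "measure_pmf.prob (D (-e)) {x. gap_maj m \<gamma> x = Some False} \<ge> 1 - 1/33"
  proof (rule small)
    have "measure_pmf.prob (D (-e)) (- {x. gap_maj m \<gamma> x = Some False}) =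
        measure_pmf.prob (coins m (\<lambda>_. 1/2 + -e)) {x. \<not> real (card {i. i < m \<and> x i}) \<le> m/2 - \<gamma>}"
      unfolding D_def measure_map_pmf using \<gamma>
      by (intro arg_cong[where f = "measure_pmf.prob _"]) (auto simp: gap_maj_def card_eq)
    also have "\<dots> \<le> measure_pmf.prob (coins m (\<lambda>_. 1/2 + -e))
          {x. real (card {i. i < m \<and> x i}) \<ge> m/2 + m * -e + \<gamma>}"
      by (intro measure_pmf.finite_measure_mono) (auto simp: me)
    also have "\<dots> \<le> exp (-2 * \<gamma>\<^sup>2 / m)"
      unfolding coins_def
      using prob_Pi_pmf_count_ge[OF m, where \<epsilon> = \<gamma> and Q = "\<lambda>_ y. y"
        and p = "\<lambda>_. bernoulli_pmf (1/2 + -e)"] \<gamma>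
      unfolding sum_eq[OF e(2)] by auto
    finally show "measure_pmf.prob (D (-e)) (- {x. gap_maj m \<gamma> x = Some False}) \<le> 1/33"
      using \<gamma>(3) by simp
  qed
  have acc: "measure_pmf.prob (D e') {x. dt_eval t x} = accept_prob m (\<lambda>_. 1/2 + e') t" for e' t
    by (simp add: D_def accept_prob_def vimage_def)
  obtain t where t: "dt_on m t" "dt_depth t \<le> rand_query m (gap_maj m \<gamma>)"
      "accept_prob m (\<lambda>_. 1/2 + e) t - accept_prob m (\<lambda>_. 1/2 + -e) t \<ge> 1/3 - 4/3 * (1/33)"
    using rand_query_distinguisher[OF is_pbf_gap_maj D1 D0] unfolding acc by blast
  show False
    \<comment> \<open>Two deviations of at most 1/8 from fair coins give 1/4, less than the
      advantage 1/3 - 4/99 = 29/99.\<close>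
    using t(3) accept_prob_biased_coins[OF e(1) t(1,2) q] accept_prob_biased_coins[OF e(2) t(1,2)] q
    unfolding power2_minus by linarith
qed

section \<open>The approximate index function\<close>

text \<open>This is \<open>k\<close> minus the Hamming distance, so
  \<open>agreement k a j \<ge> \<theta>\<close> describes a Hamming ball around
  \<open>a\<close>.\<close>

definition agreement :: "nat \<Rightarrow> (nat \<Rightarrow> bool) \<Rightarrow> nat \<Rightarrow> nat" where
  "agreement k a j = card {i. i < k \<and> a i = bit j i}"

text \<open>The first \<open>k\<close> bits are the address, the remaining \<open>2 ^ k\<close> bits are cells indexed by the numbers
  \<open>j < 2 ^ k\<close>, read as bit strings of length \<open>k\<close>.\<close>

definition approx_index :: "nat \<Rightarrow> real \<Rightarrow> pbf" where
  "approx_index k \<theta> x =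
    (if length x \<noteq> k + 2 ^ k then None
     else if \<forall>j<2 ^ k. \<not> x ! (k + j) then Some False
     else if \<forall>j<2 ^ k. x ! (k + j) \<longleftrightarrow> real (agreement k ((!) x) j) \<ge> \<theta> then Some True
     else None)"

lemma is_pbf_approx_index: "is_pbf (k + 2 ^ k) (approx_index k \<theta>)"
  by (auto simp: is_pbf_def approx_index_def split: if_splits)

definition address_of :: "bool list \<Rightarrow> nat" where
  "address_of bs = horner_sum of_bool 2 bs"

lemma address_of_less: "address_of bs < 2 ^ length bs"
proof -
  have "int (address_of bs) = horner_sum of_bool 2 bs"
    by (induction bs) (auto simp: address_of_def)
  also have "\<dots> < 2 ^ length bs" by (rule horner_sum_of_bool_2_less)
  finally have "int (address_of bs) < int (2 ^ length bs)" by simp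
  thus ?thesis by (simp only: of_nat_less_iff)
qed

lemma bit_address_of: "i < length bs \<Longrightarrow> bit (address_of bs) i = bs ! i"
  by (simp add: address_of_def bit_horner_sum_bit_iff)

text \<open>\<open>input0\<close> and \<open>input1\<close> form the hard pair: for equal
  \<open>a\<close> they differ only in the cells of the ball around \<open>a\<close>.\<close>

definition input0 :: "nat \<Rightarrow> (nat \<Rightarrow> bool) \<Rightarrow> bool list" where
  "input0 k a = map a [0..<k] @ replicate (2 ^ k) False"

definition input1 :: "nat \<Rightarrow> real \<Rightarrow> (nat \<Rightarrow> bool) \<Rightarrow> bool list" where
  "input1 k \<theta> a = map a [0..<k] @ map (\<lambda>j. real (agreement k a j) \<ge> \<theta>) [0..<2 ^ k]"

lemma approx_index_input0: "approx_index k \<theta> (input0 k a) = Some False"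
  by (simp add: approx_index_def input0_def nth_append)

lemma approx_index_input1:
  assumes "\<theta> \<le> real k"
  shows "approx_index k \<theta> (input1 k \<theta> a) = Some True"
proof -
  \<comment> \<open>The cell indexed by the address itself has full agreement, so the array is not
    all zero and the value is not \<open>False\<close>.\<close>
  define j where "j = address_of (map a [0..<k])"
  have j: "j < 2 ^ k" using address_of_less[of "map a [0..<k]"] by (simp add: j_def)
  have "{i. i < k \<and> a i = bit j i} = {..<k}" by (auto simp: j_def bit_address_of)
  hence "agreement k a j = k" by (simp add: agreement_def)
  hence 1: "\<not> (\<forall>j<2 ^ k. \<not> input1 k \<theta> a ! (k + j))"
    using j assms by (auto simp: input1_def nth_append intro!: exI[of _ j])
  have "agreement k ((!) (input1 k \<theta> a)) j = agreement k a j" for j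
    unfolding agreement_def by (intro arg_cong[where f = card]) (auto simp: input1_def nth_append)
  thus ?thesis using 1 by (simp add: approx_index_def) (simp add: input1_def nth_append)
qed

text \<open>Each of the at most \<open>s\<close> known bits raises the expected agreement by at most
  1/2, so the threshold still exceeds the mean by \<open>s/2\<close>.\<close>

lemma prob_agreement_ge:
  fixes s :: real
  assumes k: "k > 0" and p: "\<And>i. i < k \<Longrightarrow> p i \<in> {0, 1/2, 1}"
    and s: "real (card {i. i < k \<and> p i \<noteq> 1/2}) \<le> s"
  shows "measure_pmf.prob (coins k p) {a. real (agreement k a j) \<ge> k/2 + s}
    \<le> exp (- s\<^sup>2 / (2 * real k))"
proof -
  define F where "F = {i. i < k \<and> p i \<noteq> 1/2}"
  define \<mu> where "\<mu> = (\<Sum>i<k. measure_pmf.prob (bernoulli_pmf (p i)) {y. y = bit j i})"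
  have s0: "0 \<le> s" using s by linarith
  have "\<mu> \<le> (\<Sum>i<k. 1/2 + of_bool (i \<in> F) / 2)" unfolding \<mu>_def
  proof (rule sum_mono)
    fix i assume i: "i \<in> {..<k}"
    show "measure_pmf.prob (bernoulli_pmf (p i)) {y. y = bit j i} \<le> 1/2 + of_bool (i \<in> F) / 2"
    proof (cases "i \<in> F")
      case False
      hence "p i = 1/2" using i by (auto simp: F_def)
      hence "measure_pmf.prob (bernoulli_pmf (p i)) {bit j i} = 1/2"
        by (cases "bit j i") (simp_all add: measure_pmf_single)
      thus ?thesis by simp
    qed simp
  qed
  also have "\<dots> = k/2 + card F / 2"
  proof -
    have "{..<k} \<inter> F = F" by (auto simp: F_def)
    thus ?thesis by (simp add: sum.distrib sum_divide_distrib[symmetric] of_bool_def sum.If_cases)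
  qed
  also have "\<dots> \<le> k/2 + s/2" using s by (simp add: F_def)
  finally have \<mu>: "\<mu> \<le> k/2 + s/2" .
  have "measure_pmf.prob (coins k p) {a. real (agreement k a j) \<ge> k/2 + s} \<le>
      measure_pmf.prob (coins k p) {a. real (card {i. i < k \<and> a i = bit j i}) \<ge> \<mu> + s/2}"
    using \<mu> by (intro measure_pmf.finite_measure_mono) (auto simp: agreement_def)
  also have "\<dots> \<le> exp (-2 * (s/2)\<^sup>2 / k)"
    unfolding \<mu>_def coins_def using s0 by (intro prob_Pi_pmf_count_ge[OF k]) simp
  also have "-2 * (s/2)\<^sup>2 / k = - s\<^sup>2 / (2 * real k)" by (simp add: power2_eq_square)
  finally show ?thesis .
qed

text \<open>A union bound over the cells read. The invariant is that known address bits plus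
  remaining depth stay below \<open>s\<close>, so \<open>prob_agreement_ge\<close> applies at every
  cell query.\<close>

lemma prob_tree_hits_ball:
  fixes s :: real
  assumes k: "k > 0" and t: "dt_on (k + 2 ^ k) t" and p: "\<And>i. i < k \<Longrightarrow> p i \<in> {0, 1/2, 1}"
    and s: "real (card {i. i < k \<and> p i \<noteq> 1/2} + dt_depth t) \<le> s"
  shows "measure_pmf.prob (coins k p) {a. dt_eval t (input0 k a) \<noteq> dt_eval t (input1 k (k/2 + s) a)}
     \<le> dt_depth t * exp (- s\<^sup>2 / (2 * real k))"
  using t p s
proof (induction t arbitrary: p)
  case (Leaf b)
  thus ?case by simp
next
  case (Query i t0 t1)
  let ?\<theta> = "k/2 + s" and ?E = "exp (- s\<^sup>2 / (2 * real k))"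
  let ?B = "\<lambda>t. {a. dt_eval t (input0 k a) \<noteq> dt_eval t (input1 k ?\<theta> a)}"
  let ?d = "max (dt_depth t0) (dt_depth t1)"
  have E: "?E \<ge> 0" by simp
  show ?case
  proof (cases "i < k")
    case True
    have nth: "input0 k a ! i = a i" "input1 k ?\<theta> a ! i = a i" for a
      using True by (simp_all add: input0_def input1_def nth_append)
    \<comment> \<open>Reading an address bit adds at most one known bit and uses up one level of
      depth.\<close>
    have fixed: "measure_pmf.prob (coins k (p(i := of_bool c))) (?B (Query i t0 t1)) \<le> ?d * ?E"
      if "p i \<in> {1/2, of_bool c}" for c
    proof -
      let ?p = "p(i := of_bool c)" and ?t = "if c then t1 else t0"
      have "dt_depth ?t \<le> ?d" by auto
      have "{j. j < k \<and> ?p j \<noteq> 1/2} \<subseteq> insert i {j. j < k \<and> p j \<noteq> 1/2}" by auto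
      hence "card {j. j < k \<and> ?p j \<noteq> 1/2} \<le> card (insert i {j. j < k \<and> p j \<noteq> 1/2})"
        by (intro card_mono) auto
      also have "\<dots> \<le> Suc (card {j. j < k \<and> p j \<noteq> 1/2})" by (simp add: card_insert_if)
      finally have "card {j. j < k \<and> ?p j \<noteq> 1/2} + dt_depth ?t \<le>
          card {j. j < k \<and> p j \<noteq> 1/2} + dt_depth (Query i t0 t1)"
        using \<open>dt_depth ?t \<le> ?d\<close> unfolding dt_depth.simps by linarith
      hence "real (card {j. j < k \<and> ?p j \<noteq> 1/2} + dt_depth ?t) \<le> s"
        using Query.prems(3) by (meson of_nat_mono order_trans)
      hence "measure_pmf.prob (coins k ?p) (?B ?t) \<le> dt_depth ?t * ?E"
        using Query.IH Query.prems(1,2) by (cases c) auto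
      also have "\<dots> \<le> ?d * ?E" by (intro mult_right_mono) auto
      also have "measure_pmf.prob (coins k ?p) (?B ?t) =
          measure_pmf.prob (coins k ?p) (?B (Query i t0 t1))"
      proof (intro measure_pmf.finite_measure_eq_AE, unfold AE_measure_pmf_iff, intro ballI)
        fix a assume "a \<in> set_pmf (coins k ?p)"
        hence "a i = c" by (rule coins_fixed[OF True])
        thus "(a \<in> ?B ?t) = (a \<in> ?B (Query i t0 t1))" by (simp add: nth)
      qed auto
      finally show ?thesis .
    qed
    have "measure_pmf.prob (coins k p) (?B (Query i t0 t1)) \<le> ?d * ?E"
    proof -
      have "p i \<in> {0, 1/2, 1}" using Query.prems(2) True by blast
      then consider "p i = 0" | "p i = 1/2" | "p i = 1" by blast
      thus ?thesis
      proof cases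
        case 1
        hence "p(i := of_bool False) = p" by auto
        thus ?thesis using fixed[of False] 1 by simp
      next
        case 2
        define S where "S = ?B (Query i t0 t1)"
        have "measure_pmf.prob (coins k (p(i := 0))) S \<le> ?d * ?E"
          "measure_pmf.prob (coins k (p(i := 1))) S \<le> ?d * ?E"
          using fixed[of False] fixed[of True] 2 unfolding S_def by auto
        moreover have "measure_pmf.prob (coins k p) S = 1/2 * measure_pmf.prob (coins k (p(i := 1))) S
            + (1 - 1/2) * measure_pmf.prob (coins k (p(i := 0))) S"
          unfolding 2[symmetric] using 2 by (intro prob_coins_split[OF True]) auto
        moreover have "z \<le> c" if "x \<le> c" "y \<le> c" "z = 1/2 * y + (1 - 1/2) * x" for x y z c :: real
          using that by simp
        ultimately show ?thesis unfolding S_def[symmetric] by blast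
      next
        case 3
        hence "p(i := of_bool True) = p" by auto
        thus ?thesis using fixed[of True] 3 by simp
      qed
    qed
    also have "\<dots> \<le> dt_depth (Query i t0 t1) * ?E" by (intro mult_right_mono) auto
    finally show ?thesis .
  next
    case False
    define j where "j = i - k"
    have j: "i = k + j" "j < 2 ^ k" using False Query.prems(1) by (auto simp: j_def)
    have nth: "input0 k a ! i = False" "input1 k ?\<theta> a ! i = (real (agreement k a j) \<ge> ?\<theta>)" for a
      using j by (simp_all add: input0_def input1_def nth_append)
    \<comment> \<open>Outside the ball both inputs answer \<open>False\<close> and both runs
      continue in \<open>t0\<close>.\<close>
    have "measure_pmf.prob (coins k p) (?B (Query i t0 t1)) \<le>
        measure_pmf.prob (coins k p) ({a. real (agreement k a j) \<ge> ?\<theta>} \<union> ?B t0)"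
      by (intro measure_pmf.finite_measure_mono) (auto simp: nth)
    also have "\<dots> \<le> measure_pmf.prob (coins k p) {a. real (agreement k a j) \<ge> ?\<theta>} +
        measure_pmf.prob (coins k p) (?B t0)"
      by (rule measure_Un_le) auto
    also have "\<dots> \<le> ?E + dt_depth t0 * ?E"
      using Query.prems by (intro add_mono Query.IH(1) prob_agreement_ge k) auto
    also have "\<dots> = Suc (dt_depth t0) * ?E" by (simp add: algebra_simps)
    also have "\<dots> \<le> dt_depth (Query i t0 t1) * ?E" by (intro mult_right_mono) auto
    finally show ?thesis .
  qed
qed

text \<open>For a uniform address, a tree of depth at most \<open>s\<close> would have to separate
  \<open>input1\<close> from \<open>input0\<close> with advantage 1/3, but it rarely meets a cell
  where they differ.\<close>

lemma rand_query_approx_index: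
  fixes s :: real
  assumes k: "k > 0" and s: "s \<le> k/2" "s * exp (- s\<^sup>2 / (2 * real k)) < 1/3"
  shows "real (rand_query (k + 2 ^ k) (approx_index k (k/2 + s))) > s"
proof (rule ccontr)
  let ?q = "rand_query (k + 2 ^ k) (approx_index k (k/2 + s))"
  let ?\<theta> = "k/2 + s"
  assume "\<not> ?thesis"
  hence q: "real ?q \<le> s" by simp
  define U where "U = coins k (\<lambda>_. 1/2)"
  have val1: "approx_index k ?\<theta> (input1 k ?\<theta> a) = Some True" for a
    using s by (intro approx_index_input1) simp
  obtain t where t: "dt_on (k + 2 ^ k) t" "dt_depth t \<le> ?q"
    and dist: "measure_pmf.prob (map_pmf (input1 k ?\<theta>) U) {x. dt_eval t x} -
       measure_pmf.prob (map_pmf (input0 k) U) {x. dt_eval t x} \<ge> 1/3 - 4/3 * 0"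
    using rand_query_distinguisher[OF is_pbf_approx_index[of k ?\<theta>],
        where ?D1.0 = "map_pmf (input1 k ?\<theta>) U" and ?D0.0 = "map_pmf (input0 k) U" and \<eta> = 0]
    by (auto simp: approx_index_input0 val1 vimage_def)
  have "measure_pmf.prob U {a. dt_eval t (input1 k ?\<theta> a)} \<le>
      measure_pmf.prob U ({a. dt_eval t (input0 k a)} \<union>
        {a. dt_eval t (input0 k a) \<noteq> dt_eval t (input1 k ?\<theta> a)})"
    by (intro measure_pmf.finite_measure_mono) auto
  also have "\<dots> \<le> measure_pmf.prob U {a. dt_eval t (input0 k a)} +
      measure_pmf.prob U {a. dt_eval t (input0 k a) \<noteq> dt_eval t (input1 k ?\<theta> a)}"
    by (rule measure_Un_le) auto
  finally have "1/3 \<le> measure_pmf.prob U {a. dt_eval t (input0 k a) \<noteq> dt_eval t (input1 k ?\<theta> a)}"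
    using dist by (simp add: vimage_def)
  also have "\<dots> \<le> dt_depth t * exp (- s\<^sup>2 / (2 * real k))"
    unfolding U_def using t q by (intro prob_tree_hits_ball k) auto
  also have "\<dots> \<le> s * exp (- s\<^sup>2 / (2 * real k))" using t q by (intro mult_right_mono) auto
  finally show False using s by simp
qed

section \<open>The composition\<close>

text \<open>The continuation makes later queries adaptive: the sampled address selects the block to
  be read.\<close>

fun read_bits :: "nat list \<Rightarrow> (bool list \<Rightarrow> dtree) \<Rightarrow> dtree" where
  "read_bits [] c = c []"
| "read_bits (i # is) c =
     Query i (read_bits is (\<lambda>bs. c (False # bs))) (read_bits is (\<lambda>bs. c (True # bs)))"

lemma dt_eval_read_bits: "dt_eval (read_bits is c) x = dt_eval (c (map ((!) x) is)) x"
  by (induction "is" arbitrary: c) auto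

lemma dt_depth_read_bits: "(\<And>bs. dt_depth (c bs) \<le> d) \<Longrightarrow> dt_depth (read_bits is c) \<le> length is + d"
  by (induction "is" arbitrary: c) auto

lemma dt_on_read_bits:
  "(\<And>bs. length bs = length is \<Longrightarrow> dt_on n (c bs)) \<Longrightarrow> (\<And>i. i \<in> set is \<Longrightarrow> i < n) \<Longrightarrow>
    dt_on n (read_bits is c)"
  by (induction "is" arbitrary: c) auto

text \<open>All randomness sits in \<open>r\<close>, the position sampled in each address block. The
  sampled address is only a noisy guess; the value of the selected cell is computed exactly.\<close>

definition sample_tree :: "nat \<Rightarrow> nat \<Rightarrow> pbf \<Rightarrow> (nat \<Rightarrow> nat) \<Rightarrow> dtree" where
  "sample_tree k m g r = read_bits (map (\<lambda>i. i * m + r i) [0..<k])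
     (\<lambda>bs. read_bits (map (\<lambda>l. (k + address_of bs) * m + l) [0..<m]) (\<lambda>ys. Leaf (the (g ys))))"

lemma dt_depth_sample_tree: "dt_depth (sample_tree k m g r) \<le> k + m"
proof -
  have "dt_depth (sample_tree k m g r) \<le> length (map (\<lambda>i. i * m + r i) [0..<k]) +
      (length [0..<m] + 0)"
    unfolding sample_tree_def
    by (intro dt_depth_read_bits order_trans[OF dt_depth_read_bits[of _ 0]]) auto
  thus ?thesis by simp
qed

lemma block_index_less: "i < n \<Longrightarrow> l < m \<Longrightarrow> i * m + l < n * (m :: nat)"
  by (metis add_less_cancel_left less_le_trans mult_Suc mult_le_mono1 Suc_leI add.commute)

lemma dt_on_sample_tree:
  assumes "\<And>i. i < k \<Longrightarrow> r i < m"
  shows "dt_on ((k + 2 ^ k) * m) (sample_tree k m g r)"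
  unfolding sample_tree_def
proof (intro dt_on_read_bits)
  fix bs :: "bool list" and i assume "length bs = length (map (\<lambda>i. i * m + r i) [0..<k])"
    "i \<in> set (map (\<lambda>l. (k + address_of bs) * m + l) [0..<m])"
  then obtain l where "i = (k + address_of bs) * m + l" "l \<in> set [0..<m]" "length bs = k"
    unfolding set_map by fastforce
  thus "i < (k + 2 ^ k) * m" using address_of_less[of bs]
    by (auto simp only: set_upt atLeastLessThan_iff intro!: block_index_less)
qed (use assms in \<open>auto intro!: block_index_less\<close>)

lemma nth_blocks:
  assumes "length x = n * m" "i < n"
  shows "blocks n m x ! i = map (\<lambda>l. x ! (i * m + l)) [0..<m]"
proof -
  have "i * m + m \<le> n * m" using assms(2) by (metis Suc_leI add.commute mult_Suc mult_le_mono1)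
  thus ?thesis using assms by (auto simp: blocks_def intro!: nth_equalityI)
qed

text \<open>The sampled address has expected agreement at least \<open>k/2 + 2 * s\<close> with the
  true one, so by Hoeffding it falls below \<open>k/2 + s\<close> with probability at most
  1/3.\<close>

lemma rand_query_comp_le:
  fixes s \<gamma> :: real
  assumes k: "k > 0" and m: "m > 0" and \<gamma>: "\<gamma> > 0"
    and s: "s \<ge> 0" "2 * s \<le> k * (\<gamma> / m)" "exp (-2 * s\<^sup>2 / k) \<le> 1/3"
  shows "rand_query ((k + 2 ^ k) * m)
    (pbf_comp (k + 2 ^ k) m (approx_index k (k/2 + s)) (gap_maj m \<gamma>)) \<le> k + m"
  unfolding rand_query_def
proof (rule Least_le, intro exI conjI)
  let ?n = "k + 2 ^ k" and ?g = "gap_maj m \<gamma>" and ?\<theta> = "k/2 + s"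
  define R where "R = Pi_pmf {..<k} 0 (\<lambda>_. pmf_of_set {..<m})"
  define P where "P = map_pmf (sample_tree k m ?g) R"
  have ne: "{..<m} \<noteq> {}" using m by auto
  have R: "r i < m" if "r \<in> set_pmf R" "i < k" for r i
    using that ne by (auto simp: R_def set_Pi_pmf PiE_dflt_def)
  show "rdt_on (?n * m) P"
    using R by (auto simp: rdt_on_def P_def intro!: dt_on_sample_tree)
  show "\<forall>t\<in>set_pmf P. dt_depth t \<le> k + m"
    by (auto simp: P_def dt_depth_sample_tree)
  show "rdt_computes P (pbf_comp ?n m (approx_index k ?\<theta>) ?g) (1/3)"
    unfolding rdt_computes_def
  proof
    fix x assume "x \<in> dom (pbf_comp ?n m (approx_index k ?\<theta>) ?g)"
    then obtain v where v: "pbf_comp ?n m (approx_index k ?\<theta>) ?g x = Some v" by blast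
    define y where "y = map (\<lambda>z. the (?g z)) (blocks ?n m x)"
    from v have x: "length x = ?n * m" "\<And>z. z \<in> set (blocks ?n m x) \<Longrightarrow> z \<in> dom ?g"
      and fy: "approx_index k ?\<theta> y = Some v"
      by (auto simp: pbf_comp_def y_def split: if_splits)
    have len: "length (blocks ?n m x) = ?n" by (simp add: blocks_def)
    have y: "?g (map (\<lambda>l. x ! (i * m + l)) [0..<m]) = Some (y ! i)" if "i < ?n" for i
    proof -
      have "blocks ?n m x ! i \<in> dom ?g" using that len by (intro x(2)) auto
      thus ?thesis using that len nth_blocks[OF x(1) that] by (auto simp: y_def)
    qed
    define j where "j = (\<lambda>r. address_of (map (\<lambda>i. x ! (i * m + r i)) [0..<k]))"
    have j: "j r < 2 ^ k" for r
      using address_of_less[of "map (\<lambda>i. x ! (i * m + r i)) [0..<k]"] by (simp add: j_def)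
    have eval: "dt_eval (sample_tree k m ?g r) x = y ! (k + j r)" for r
      using y[of "k + j r"] j[of r] by (simp add: sample_tree_def dt_eval_read_bits j_def o_def)
    have "measure_pmf.prob R {r. y ! (k + j r) = v} \<ge> 2/3"
    proof (cases v)
      \<comment> \<open>All cells are zero here, so the answer is right whichever cell is
        selected.\<close>
      case False
      hence "\<And>j. j < 2 ^ k \<Longrightarrow> \<not> y ! (k + j)" using fy
        by (auto simp: approx_index_def split: if_splits)
      hence "{r. y ! (k + j r) = v} = UNIV" using False j by auto
      thus ?thesis by simp
    next
      case True
      hence cell: "y ! (k + l) \<longleftrightarrow> real (agreement k ((!) y) l) \<ge> ?\<theta>" if "l < 2 ^ k" for l
        using fy that by (auto simp: approx_index_def split: if_splits)
      have agr: "agreement k ((!) y) (j r) = card {i. i < k \<and> x ! (i * m + r i) = y ! i}" for r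
        unfolding agreement_def j_def by (intro arg_cong[where f = card]) (auto simp: bit_address_of)
      define \<mu> where "\<mu> = (\<Sum>i<k. measure_pmf.prob (pmf_of_set {..<m}) {u. x ! (i * m + u) = y ! i})"
      have mean: "measure_pmf.prob (pmf_of_set {..<m}) {u. x ! (i * m + u) = y ! i} \<ge> 1/2 + \<gamma> / m"
        if i: "i < k" for i
      proof -
        let ?T = "{u. u < m \<and> x ! (i * m + u)}" and ?F = "{u. u < m \<and> \<not> x ! (i * m + u)}"
        have T: "{u. u < m \<and> map (\<lambda>l. x ! (i * m + l)) [0..<m] ! u} = ?T" by auto
        \<comment> \<open>Counting zeros as well turns the upper bound on ones, in a block of value
          \<open>False\<close>, into a lower bound on matching positions.\<close>
        have "card ?T + card ?F = card (?T \<union> ?F)" by (intro card_Un_disjoint[symmetric]) auto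
        also have "?T \<union> ?F = {..<m}" by auto
        finally have "real (card ?T) + real (card ?F) = m" by simp
        moreover have "if y ! i then real (card ?T) \<ge> m/2 + \<gamma> else real (card ?T) \<le> m/2 - \<gamma>"
          using y[of i] i T by (auto simp: gap_maj_def split: if_splits)
        moreover have "{..<m} \<inter> {u. x ! (i * m + u) = y ! i} = (if y ! i then ?T else ?F)" by auto
        ultimately have "real (card ({..<m} \<inter> {u. x ! (i * m + u) = y ! i})) \<ge> m/2 + \<gamma>"
          by (auto split: if_splits)
        hence "(m/2 + \<gamma>) / m \<le> card ({..<m} \<inter> {u. x ! (i * m + u) = y ! i}) / m"
          by (intro divide_right_mono) auto
        thus ?thesis using m ne by (simp add: measure_pmf_of_set add_divide_distrib)
      qed
      have "k/2 + 2 * s \<le> (\<Sum>i<k. 1/2 + \<gamma> / m)" using s by (simp add: algebra_simps)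
      also have "\<dots> \<le> \<mu>" unfolding \<mu>_def by (intro sum_mono mean) auto
      finally have \<mu>: "k/2 + 2 * s \<le> \<mu>" .
      let ?G = "{r. y ! (k + j r) = v}"
      have "measure_pmf.prob R (UNIV - ?G) \<le>
          measure_pmf.prob R {r. real (card {i. i < k \<and> x ! (i * m + r i) = y ! i}) \<le> \<mu> - s}"
        using True \<mu> cell[OF j] agr by (intro measure_pmf.finite_measure_mono) auto
      also have "\<dots> \<le> exp (-2 * s\<^sup>2 / k)"
        unfolding R_def \<mu>_def by (rule prob_Pi_pmf_count_le[OF k s(1)])
      finally show ?thesis using measure_pmf.prob_compl[of ?G R] s(3) by simp
    qed
    thus "measure_pmf.prob P {t. dt_eval t x = the (pbf_comp ?n m (approx_index k ?\<theta>) ?g x)} \<ge> 1 - 1/3"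
      by (simp add: P_def v vimage_def eval)
  qed
qed

section \<open>Choice of parameters and asymptotics\<close>

lemma rand_query_gap_maj_ge:
  assumes "n \<ge> 4"
  shows "real (rand_query (4 * 4 ^ n) (gap_maj (4 * 4 ^ n) (8 * 2 ^ n))) \<ge> 4 ^ n / 8192"
proof (rule ccontr)
  define q where "q = rand_query (4 * 4 ^ n) (gap_maj (4 * 4 ^ n) (8 * 2 ^ n))"
  assume "\<not> ?thesis"
  hence q: "64 / 4 ^ n * real q \<le> 1/128" by (simp add: q_def field_simps)
  have four: "(4::real) ^ n = 2 ^ n * 2 ^ n" by (simp flip: power_mult_distrib)
  \<comment> \<open>The gap condition amounts to 2 ^ n > 8, hence the assumption on
    \<open>n\<close>.\<close>
  have "(2::real) ^ n \<ge> 2 ^ 4" using assms by (intro power_increasing) auto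
  hence gap: "4 * (8 * 2 ^ n) < real (4 * 4 ^ n)" by (simp add: four)
  have "exp (-2 * (8 * 2 ^ n)\<^sup>2 / real (4 * 4 ^ n)) = inverse (exp 32)"
    by (simp add: four power2_eq_square exp_minus)
  also have "\<dots> \<le> inverse (1 + 32)" by (intro le_imp_inverse_le exp_ge_add_one_self) simp
  finally have tail: "exp (-2 * (8 * 2 ^ n)\<^sup>2 / real (4 * 4 ^ n)) \<le> 1/33" by simp
  have "65/64 < (1 + 4 * (2 * (8 * 2 ^ n) / real (4 * 4 ^ n))\<^sup>2) ^ q"
    unfolding q_def by (rule rand_query_gap_maj) (use gap tail in auto)
  also have "4 * (2 * (8 * 2 ^ n) / real (4 * 4 ^ n))\<^sup>2 = 64 / 4 ^ n"
    by (simp add: four power2_eq_square)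
  \<comment> \<open>Since 64 / 8192 = 1/128, a smaller \<open>q\<close> keeps the product below exp
    (1/128) \<le> 1 + 2/128.\<close>
  also have "(1 + 64 / 4 ^ n) ^ q \<le> exp (64 / 4 ^ n :: real) ^ q"
    by (intro power_mono exp_ge_add_one_self) auto
  also have "\<dots> = exp (64 / 4 ^ n * real q)" by (simp add: exp_of_nat_mult[symmetric] mult.commute)
  also have "\<dots> \<le> exp (1/128)" using q by simp
  also have "\<dots> \<le> 65/64" using exp_bound_lemma[of "1/128::real"] by simp
  finally show False by simp
qed

theorem theorem1p2:
  "\<exists>(a :: nat \<Rightarrow> nat) (b :: nat \<Rightarrow> nat) (f :: nat \<Rightarrow> pbf) (g :: nat \<Rightarrow> pbf).
     (\<forall>n\<ge>1. is_pbf (a n) (f n) \<and> is_pbf (b n) (g n)) \<and>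
     filterlim (\<lambda>n. rand_query (a n) (f n)) at_top sequentially \<and>
     filterlim (\<lambda>n. rand_query (b n) (g n)) at_top sequentially \<and>
     (\<lambda>n. real (rand_query (a n * b n) (pbf_comp (a n) (b n) (f n) (g n))))
       \<in> O[sequentially](\<lambda>n. real (rand_query (a n) (f n)) powr (2/3)
            * real (rand_query (b n) (g n)) powr (2/3)
            * (log 2 (real (rand_query (a n) (f n)))) powr (2/3))"
proof -
  define k where "k = (\<lambda>n::nat. n\<^sup>2 * 4 ^ n)"
  define s where "s = (\<lambda>n::nat. real n ^ 2 * 2 ^ n)"
  define b where "b = (\<lambda>n::nat. 4 * 4 ^ n :: nat)"
  define a where "a = (\<lambda>n. k n + 2 ^ k n)"
  define f where "f = (\<lambda>n. approx_index (k n) (k n / 2 + s n))"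
  define g where "g = (\<lambda>n. gap_maj (b n) (8 * 2 ^ n))"
  define F where "F = (\<lambda>n. rand_query (a n) (f n))"
  define G where "G = (\<lambda>n. rand_query (b n) (g n))"
  define C where "C = (\<lambda>n. rand_query (a n * b n) (pbf_comp (a n) (b n) (f n) (g n)))"
  have four: "(4::real) ^ n = 2 ^ n * 2 ^ n" for n by (simp flip: power_mult_distrib)
  have s2: "(s n)\<^sup>2 / k n = (real n)\<^sup>2" if "n \<ge> 1" for n
    using that by (simp add: s_def k_def four power2_eq_square)

  \<comment> \<open>As \<open>s\<^sup>2 / k\<close> is \<open>n\<^sup>2\<close>, the Gaussian tail
    beats the number of queries \<open>s\<close>, which grows like
    \<open>n\<^sup>2 * 2 ^ n\<close>.\<close>
  have "eventually (\<lambda>n::nat. (real n)\<^sup>2 * 2 ^ n * exp (- (real n)\<^sup>2 / 2) < 1/3) at_top"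
    by real_asymp
  hence F: "eventually (\<lambda>n. real (F n) > s n) at_top"
    using eventually_ge_at_top[of 1]
  proof eventually_elim
    case (elim n)
    have "(1::real) * 2 \<le> 2 ^ n" using elim(2) power_increasing[of 1 n "2::real"] by simp
    hence "(real n)\<^sup>2 * 2 ^ n * (1 * 2) \<le> (real n)\<^sup>2 * 2 ^ n * 2 ^ n" by (intro mult_left_mono) auto
    hence "s n \<le> k n / 2" by (simp add: s_def k_def four mult.assoc)
    moreover have "s n * exp (- (s n)\<^sup>2 / (2 * real (k n))) < 1/3"
    proof -
      have "- (s n)\<^sup>2 / (2 * real (k n)) = - ((s n)\<^sup>2 / k n) / 2" by simp
      also have "\<dots> = - (real n)\<^sup>2 / 2" by (simp only: s2[OF elim(2)])
      finally show ?thesis using elim(1) by (simp only: s_def)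
    qed
    moreover have "k n > 0" using elim(2) by (simp add: k_def)
    ultimately show ?case
      unfolding F_def f_def a_def by (intro rand_query_approx_index) auto
  qed
  have G: "eventually (\<lambda>n. real (G n) \<ge> 4 ^ n / 8192) at_top"
    using eventually_ge_at_top[of 4]
    by eventually_elim (unfold G_def g_def b_def, rule rand_query_gap_maj_ge)
  have C: "eventually (\<lambda>n. C n \<le> k n + b n) at_top"
    using eventually_ge_at_top[of 1]
  proof eventually_elim
    case (elim n)
    have "exp (-2 * (s n)\<^sup>2 / k n) = inverse (exp (2 * (real n)\<^sup>2))"
      using s2[OF elim] by (simp add: exp_minus)
    also have "\<dots> \<le> inverse (1 + 2 * (real n)\<^sup>2)"
      by (intro le_imp_inverse_le exp_ge_add_one_self) (simp add: add_pos_nonneg)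
    also have "\<dots> \<le> inverse 3" using elim by (intro le_imp_inverse_le) auto
    finally have "exp (-2 * (s n)\<^sup>2 / k n) \<le> 1/3" by simp
    \<comment> \<open>This holds with equality: the bias gained by sampling exactly meets the
      requirement.\<close>
    moreover have "2 * s n \<le> k n * (8 * 2 ^ n / b n)"
      by (simp add: s_def k_def b_def four)
    ultimately show ?case unfolding C_def f_def a_def g_def
      using elim by (intro rand_query_comp_le) (auto simp: k_def b_def s_def)
  qed

  have "filterlim s at_top at_top" unfolding s_def by real_asymp
  hence "filterlim (\<lambda>n. real (F n)) at_top at_top"
    by (rule filterlim_at_top_mono) (use F in eventually_elim, simp)
  hence Flim: "filterlim F at_top at_top" by (simp only: filterlim_sequentially_iff_filterlim_real)
  have "filterlim (\<lambda>n::nat. 4 ^ n / 8192 :: real) at_top at_top" by real_asymp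
  hence "filterlim (\<lambda>n. real (G n)) at_top at_top"
    using G by (rule filterlim_at_top_mono)
  hence Glim: "filterlim G at_top at_top" by (simp only: filterlim_sequentially_iff_filterlim_real)

  have "(\<lambda>n. real (C n)) \<in>
      O(\<lambda>n. real (F n) powr (2/3) * real (G n) powr (2/3) * log 2 (real (F n)) powr (2/3))"
  \<comment> \<open>The right-hand side increases in both complexities, so their lower bounds
    suffice: \<open>s\<close>, \<open>4 ^ n / 8192\<close> and \<open>n\<close> for the logarithm
    multiply to \<open>(n * 2 ^ n) ^ 3 / 8192\<close>. The upper bound \<open>k + b\<close> is at
    most \<open>5 * (n * 2 ^ n)\<^sup>2\<close>.\<close>
  proof (rule bigoI[where c = "5 * 8192 powr (2/3)"])
    show "eventually (\<lambda>n. norm (real (C n)) \<le> 5 * 8192 powr (2/3) *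
      norm (real (F n) powr (2/3) * real (G n) powr (2/3) * log 2 (real (F n)) powr (2/3))) at_top"
      using F G C eventually_ge_at_top[of 1]
    proof eventually_elim
      case (elim n)
      have n: "real n \<ge> 1" using elim by simp
      have n2: "(real n)\<^sup>2 \<ge> 1" using n by simp
      have "2 powr real n \<le> s n" using n2 by (simp add: s_def powr_realpow)
      moreover have "s n \<ge> 0" by (simp add: s_def)
      ultimately have "log 2 (real (F n)) \<ge> real n"
        using elim(1) by (subst le_log_iff) linarith+
      moreover note \<open>s n \<ge> 0\<close>
      ultimately have "s n powr (2/3) * (4 ^ n / 8192) powr (2/3) * real n powr (2/3) \<le>
          real (F n) powr (2/3) * real (G n) powr (2/3) * log 2 (real (F n)) powr (2/3)" (is "?l \<le> ?r")
        using elim(1,2) by (intro mult_mono powr_mono2) auto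
      moreover have "8192 powr (2/3) * ?l = ((real n * 2 ^ n) ^ 3) powr (2/3)"
      proof -
        have "(real n * 2 ^ n) ^ 3 = 8192 * (s n * (4 ^ n / 8192) * real n)"
          by (simp add: s_def four power2_eq_square power3_eq_cube)
        thus ?thesis by (simp only: powr_mult)
      qed
      moreover have "((real n * 2 ^ n) ^ 3) powr (2/3) = (real n * 2 ^ n)\<^sup>2"
        using n by (simp add: powr_realpow[symmetric] powr_powr del: powr_numeral)
      moreover have "real (C n) \<le> 5 * (real n * 2 ^ n)\<^sup>2"
      proof -
        have "real (C n) \<le> real (k n + b n)" using elim(3) by (simp only: of_nat_le_iff)
        also have "\<dots> = (real n)\<^sup>2 * 4 ^ n + 4 * (1 * 4 ^ n)" by (simp add: k_def b_def)
        also have "\<dots> \<le> (real n)\<^sup>2 * 4 ^ n + 4 * ((real n)\<^sup>2 * 4 ^ n)"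
          using n2 by (intro add_left_mono mult_left_mono mult_right_mono) auto
        also have "\<dots> = 5 * (real n * 2 ^ n)\<^sup>2" by (simp add: four power2_eq_square)
        finally show ?thesis .
      qed
      ultimately have "real (C n) \<le> 5 * (8192 powr (2/3) * ?l)" by simp
      also have "\<dots> \<le> 5 * (8192 powr (2/3) * ?r)"
        using \<open>?l \<le> ?r\<close> by (intro mult_left_mono) auto
      finally show ?case by simp
    qed
  qed
  moreover have "\<forall>n\<ge>1. is_pbf (a n) (f n) \<and> is_pbf (b n) (g n)"
    by (simp add: a_def f_def g_def is_pbf_approx_index is_pbf_gap_maj)
  ultimately show ?thesis
    using Flim Glim unfolding F_def G_def C_def by blast
qed

end
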